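(* The exponential generating function of the polynomials $\beta_n(x)$ is $$\sum_{n\geq 0}\beta_{n}(x)\frac{z^{n}}{n!}=(\cos(z)+x\sin(z))\,e^{xz}.$$
   Context: For each integer $n\ge 0$, $\beta_n$ is the polynomial with real coefficients determined by $\beta_n(x)=\operatorname{Im}((x+i)^{n+1})$ for real $x$, i.e. $\beta_n(x)=\sum_{k=0}^{\lfloor n/2\rfloor}(-1)^k\binom{n+1}{2k+1}x^{n-2k}$. The generating function identity is understood as an identity of formal power series in $z$. *)

theory Defs
  imports Complex_Main "HOL-Computational_Algebra.Formal_Power_Series"
    "HOL-Computational_Algebra.Polynomial"
begin

definition beta :: "nat \<Rightarrow> real poly" where
  "beta n = (THE p. \<forall>x::real. poly p x = Im ((complex_of_real x + \<i>) ^ (n + 1)))"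

lemma ex1_beta: "\<exists>!p. \<forall>x::real. poly p x = Im ((complex_of_real x + \<i>) ^ (n + 1))"
proof (rule ex_ex1I)
  have "\<exists>p q. \<forall>x::real. poly p x = Im ((complex_of_real x + \<i>) ^ m) \<and>
          poly q x = Re ((complex_of_real x + \<i>) ^ m)" for m
  proof (induction m)
    case 0
    show ?case by (rule exI[of _ 0], rule exI[of _ 1]) simp
  next
    case (Suc m)
    then obtain p q :: "real poly" where
      "\<And>x. poly p x = Im ((complex_of_real x + \<i>) ^ m)"
      "\<And>x. poly q x = Re ((complex_of_real x + \<i>) ^ m)" by blast
    then show ?case
      by (intro exI[of _ "[:0, 1:] * p + q"] exI[of _ "[:0, 1:] * q - p"]) simp
  qed
  then show "\<exists>p. \<forall>x::real. poly p x = Im ((complex_of_real x + \<i>) ^ (n + 1))" by blast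
next
  fix p q :: "real poly"
  assume "\<forall>x. poly p x = Im ((complex_of_real x + \<i>) ^ (n + 1))"
    and "\<forall>x. poly q x = Im ((complex_of_real x + \<i>) ^ (n + 1))"
  then show "p = q" by (simp add: poly_eq_poly_eq_iff[symmetric] fun_eq_iff)
qed

lemma poly_beta: "poly (beta n) x = Im ((complex_of_real x + \<i>) ^ (n + 1))"
  using theI'[OF ex1_beta[of n]] unfolding beta_def by blast

end

theory Submission imports Defs begin

unbundle fps_syntax

(* The left-hand side is the derivative in z of the series with coefficients Im ((x + i)^n) / n!,
   which is the imaginary part of exp ((x + i) z) = exp (x z) * exp (i z), i.e. sin z * exp (x z). *)

text \<open>Euler's formula and \<open>fps_sin_exp_eq_Im\<close> give the undifferentiated identity;
  the product rule then turns sin z * exp (x z) into (cos z + x sin z) * exp (x z).\<close>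

lemma Im_fps_exp_ii_nth: "Im (fps_exp \<i> $ n) = fps_sin 1 $ n"
proof -
  \<comment> \<open>Euler's formula lives over the complex numbers; these two facts show that its
    sine and cosine coefficients are real, so \<open>Im\<close> picks out the sine.\<close>
  have cos: "fps_cos (1::complex) $ n = of_real (fps_cos 1 $ n)"
    by (simp add: fps_cos_def)
  have sin: "fps_sin (1::complex) $ n = of_real (fps_sin 1 $ n)"
    by (simp add: fps_sin_def)
  have "fps_exp \<i> $ n = fps_cos 1 $ n + \<i> * fps_sin 1 $ n"
    using fps_exp_ii_sin_cos[of 1] by simp
  then show ?thesis
    unfolding cos sin by simp
qed

text \<open>Since exp (x z) has real coefficients, \<open>Im\<close> passes through each term of the
  Cauchy product of exp (i z) and exp (x z).\<close>

lemma fps_sin_exp_eq_Im: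
  fixes x :: real
  shows "fps_sin 1 * fps_exp x = Abs_fps (\<lambda>n. Im ((complex_of_real x + \<i>) ^ n) / fact n)"
proof (rule fps_ext)
  fix n
  have "Im ((complex_of_real x + \<i>) ^ n) / fact n = Im (fps_exp (\<i> + complex_of_real x) $ n)"
    using Im_divide_of_nat[of "(complex_of_real x + \<i>) ^ n" "fact n"]
    by (simp only: fps_exp_nth of_nat_fact add.commute[of \<i>])
  also have "\<dots> = (\<Sum>k=0..n. Im (fps_exp \<i> $ k * fps_exp (complex_of_real x) $ (n - k)))"
    by (simp only: fps_exp_add_mult fps_mult_nth Im_sum)
  also have "\<dots> = (\<Sum>k=0..n. fps_sin 1 $ k * fps_exp x $ (n - k))"
  proof (rule sum.cong[OF refl])
    fix k
    have "fps_exp (complex_of_real x) $ (n - k) = of_real (fps_exp x $ (n - k))"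
      by simp
    then show "Im (fps_exp \<i> $ k * fps_exp (complex_of_real x) $ (n - k)) =
        fps_sin 1 $ k * fps_exp x $ (n - k)"
      by (simp only: Im_fps_exp_ii_nth[symmetric] times_complex.sel Re_complex_of_real
          Im_complex_of_real)
  qed
  finally show "(fps_sin 1 * fps_exp x) $ n =
      Abs_fps (\<lambda>n. Im ((complex_of_real x + \<i>) ^ n) / fact n) $ n"
    by (simp add: fps_mult_nth)
qed

theorem theorem3:
  fixes x :: real
  shows "Abs_fps (\<lambda>n. poly (beta n) x / fact n)
       = (fps_cos 1 + fps_const x * fps_sin 1) * fps_exp x"
proof -
  have "Abs_fps (\<lambda>n. poly (beta n) x / fact n) =
      fps_deriv (Abs_fps (\<lambda>n. Im ((complex_of_real x + \<i>) ^ n) / fact n))"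
    proof (rule fps_ext)
    fix n
    \<comment> \<open>Differentiation shifts the index, matching the exponent n + 1 in
      \<open>beta n\<close>, and its factor \<open>Suc n\<close> lowers the factorial.\<close>
    have "real (Suc n) * (y / fact (Suc n)) = y / fact n" for y :: real
      by (simp add: fact_Suc del: of_nat_Suc)
    then show "Abs_fps (\<lambda>n. poly (beta n) x / fact n) $ n =
        fps_deriv (Abs_fps (\<lambda>n. Im ((complex_of_real x + \<i>) ^ n) / fact n)) $ n"
      by (simp only: poly_beta fps_deriv_nth fps_nth_Abs_fps Suc_eq_plus1)
  qed
  also have "\<dots> = fps_deriv (fps_sin 1 * fps_exp x)"
    by (simp only: fps_sin_exp_eq_Im)
  also have "\<dots> = (fps_cos 1 + fps_const x * fps_sin 1) * fps_exp x"
    by (simp add: fps_sin_deriv algebra_simps)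
  finally show ?thesis .
qed

end
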